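(* For every $\epsilon>0$ and every integer $d$ there is a connected graph $G$ with $n$ vertices and minimum degree $\delta$, whose diameter is bigger than $d$, such that $$\pi^*(G)\ge\left(\frac{8}{3}-\epsilon\right)\frac{n}{\delta+1}.$$
   Context: All graphs are finite and simple. A pebbling distribution $D$ on a graph $G$ is a function $D:V(G)\to\mathbb{Z}_{\ge 0}$; its size is $|D|=\sum_v D(v)$. A pebbling move removes two pebbles from a vertex having at least two pebbles and places one pebble on an adjacent vertex. A vertex $v$ is reachable under $D$ if some sequence of legal pebbling moves puts at least one pebble on $v$. $D$ is solvable if every vertex is reachable. The optimal pebbling number $\pi^*(G)$ is the minimum size of a solvable distribution on $G$. *)

theory Defs
  imports "Graph_Theory.Digraph_Component" "Graph_Theory.Shortest_Path"
begin

text \<open>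
  Finite simple graphs are the instances of \<^locale>\<open>pair_graph\<close>: finite, loop-free, symmetric
  sets of ordered pairs, so an edge between \<open>u\<close> and \<open>v\<close> is the two arcs \<open>(u, v)\<close> and \<open>(v, u)\<close>,
  and the degree of a vertex is its out-degree.
\<close>

definition min_degree :: "'a pair_pre_digraph \<Rightarrow> nat" where
  "min_degree G = Min (out_degree (with_proj G) ` pverts G)"

text \<open>The distance between two vertices is the least cost of a walk when every arc has cost 1.\<close>

definition graph_distance :: "'a pair_pre_digraph \<Rightarrow> 'a \<Rightarrow> 'a \<Rightarrow> ereal" where
  "graph_distance G u v = wf_digraph.\<mu> (with_proj G) (\<lambda>_. 1) u v"

definition graph_diameter :: "'a pair_pre_digraph \<Rightarrow> ereal" where
  "graph_diameter G = (SUP u\<in>pverts G. SUP v\<in>pverts G. graph_distance G u v)"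

text \<open>
  A pebbling distribution on \<open>G\<close> is given by a function on the whole vertex type. Values outside
  \<^term>\<open>pverts G\<close> are irrelevant: they do not count for the size, and arcs (hence moves) only
  involve vertices of \<open>G\<close>.
\<close>

type_synonym 'a pebbling_distribution = "'a \<Rightarrow> nat"

definition distribution_size :: "'a pair_pre_digraph \<Rightarrow> 'a pebbling_distribution \<Rightarrow> nat" where
  "distribution_size G D = (\<Sum>v\<in>pverts G. D v)"

definition pebbling_move ::
  "'a pair_pre_digraph \<Rightarrow> 'a pebbling_distribution \<Rightarrow> 'a pebbling_distribution \<Rightarrow> bool" where
  "pebbling_move G D D' \<longleftrightarrow>
     (\<exists>u v. (u, v) \<in> parcs G \<and> 2 \<le> D u \<and> D' = D(u := D u - 2, v := D v + 1))"

definition pebble_reachable :: "'a pair_pre_digraph \<Rightarrow> 'a pebbling_distribution \<Rightarrow> 'a \<Rightarrow> bool" where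
  "pebble_reachable G D v \<longleftrightarrow> (\<exists>D'. (pebbling_move G)\<^sup>*\<^sup>* D D' \<and> 1 \<le> D' v)"

definition solvable :: "'a pair_pre_digraph \<Rightarrow> 'a pebbling_distribution \<Rightarrow> bool" where
  "solvable G D \<longleftrightarrow> (\<forall>v\<in>pverts G. pebble_reachable G D v)"

definition optimal_pebbling_number :: "'a pair_pre_digraph \<Rightarrow> nat" where
  "optimal_pebbling_number G = (LEAST k. \<exists>D. solvable G D \<and> distribution_size G D = k)"

text \<open>The minimum is over a nonempty set, so it is attained.\<close>

lemma optimal_pebbling_number_attained:
  "\<exists>D. solvable G D \<and> distribution_size G D = optimal_pebbling_number G"
proof -
  have "solvable G (\<lambda>_. 1)"
    unfolding solvable_def pebble_reachable_def by (metis order_refl rtranclp.rtrancl_refl)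
  then have "\<exists>k D. solvable G D \<and> distribution_size G D = k" by blast
  then show ?thesis unfolding optimal_pebbling_number_def by (rule LeastI_ex)
qed

lemma optimal_pebbling_number_le:
  "solvable G D \<Longrightarrow> optimal_pebbling_number G \<le> distribution_size G D"
  unfolding optimal_pebbling_number_def by (rule Least_le) blast

end

theory Submission
  imports Defs
begin

text \<open>
  The graph is a chain of \<open>k\<close> dense blocks, consecutive blocks being joined by a single edge from
  the right end of one to the left end of the next. A block is a tensor power of a complete graph
  \<open>K\<^sub>q\<close>: its vertices are the words of length \<open>t\<close> over \<open>q\<close> letters, adjacent if they differ in all
  coordinates. For \<open>t\<close> fixed and \<open>q\<close> large almost all pairs are adjacent, so \<open>\<delta> + 1\<close> is nearly the
  size of a block; yet no set of at most \<open>t / 2\<close> vertices dominates a block. Hence every block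
  contains a vertex that is nonadjacent to both ends and to all pebbled vertices, and reaching it
  requires four pebbles brought together from the block itself (\<open>p\<close> pebbles), from the left
  (\<open>F\<close>) and from the right (\<open>H\<close>).

  The ends of a block are nonadjacent, so a pebble on the far end, inside and on the near end of a
  block is worth \<open>1/8\<close>, \<open>1/4\<close> and \<open>1/2\<close> of a pebble in the next block. By integrality
  the numbers \<open>F'\<close> and \<open>H'\<close> of pebbles leaving the block to the right and to the left satisfy
  \<open>F' + H' \<le> p / 2 + (p + F + H - 4)\<close>. In the sum over all blocks the flows cancel, leaving
  \<open>8 k \<le> 3 |D|\<close>.
\<close>

section \<open>Weighted sums under a move and the arithmetic of one block\<close>

lemma weighted_sum_move:
  fixes w D :: "'a \<Rightarrow> nat"
  assumes "finite A" "u \<noteq> v" "2 \<le> D u"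
  shows "(\<Sum>x\<in>A. w x * (D(u := D u - 2, v := D v + 1)) x) + (if u \<in> A then 2 * w u else 0)
    = (\<Sum>x\<in>A. w x * D x) + (if v \<in> A then w v else 0)"
proof -
  have "(\<Sum>x\<in>A. w x * (D(u := D u - 2, v := D v + 1)) x) + (\<Sum>x\<in>A. if x = u then 2 * w u else 0)
    = (\<Sum>x\<in>A. w x * D x) + (\<Sum>x\<in>A. if x = v then w v else 0)"
    unfolding sum.distrib [symmetric]
  proof (rule sum.cong)
    fix x
    obtain m where "D u = m + 2" using assms(3) by (metis le_add_diff_inverse2)
    then show "w x * (D(u := D u - 2, v := D v + 1)) x + (if x = u then 2 * w u else 0)
      = w x * D x + (if x = v then w v else 0)"
      using assms(2) by (auto simp: algebra_simps)
  qed simp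
  then show ?thesis using assms(1) by simp
qed

text \<open>The variables are the pebbles on the left end, inside and on the right end of a block, and the
  numbers of pebbles that enter it from the left and from the right; the two quotients bound the
  numbers that leave it. Relaxing the quotients to fractions would only give 7/3 pebbles per block
  in place of 8/3.\<close>

lemma block_balance:
  fixes l c r a b :: nat
  assumes "4 \<le> l + c + r + a + b"
  shows "2 * ((4 * r + 2 * c + l + a) div 8 + (4 * l + 2 * c + r + b) div 8) + 8
    \<le> 3 * (l + c + r) + 2 * a + 2 * b"
proof -
  define f g where "f = (4 * r + 2 * c + l + a) div 8" and "g = (4 * l + 2 * c + r + b) div 8"
  have f: "8 * f \<le> 4 * r + 2 * c + l + a" and g: "8 * g \<le> 4 * l + 2 * c + r + b"
    by (simp_all add: f_def g_def)
  have "2 * f + 2 * g + 8 \<le> 3 * l + 3 * c + 3 * r + 2 * a + 2 * b"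
  proof (cases "5 \<le> l + c + r + a + b")
    \<comment> \<open>The fractional bounds suffice once \<open>l + c + r + a + b\<close> is at
      least 32/7, so integrality matters only for the total 4.\<close>
    case True
    with f g show ?thesis by linarith
  next
    case False
    with assms have s: "l + c + r + a + b = 4" by linarith
    then consider "l + c + r = 0" | "l + c + r = 1" | "l + c + r = 2" | "l + c + r = 3"
      | "l + c + r = 4" by linarith
    then show ?thesis
    proof cases
      case 1
      then have "f + g < 1" using s f g by linarith
      then show ?thesis using s 1 by linarith
    next
      case 2
      then have "f < 1" "g < 1" using s f g by linarith+
      then show ?thesis using s 2 by linarith
    next
      case 3
      then have "f + g < 2" using s f g by linarith
      then show ?thesis using s 3 by linarith
    next
      case 4
      \<comment> \<open>A sum of 2 or more would force \<open>c = 0\<close> and make both divisions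
        exact, but \<open>3 * r + 3 + a\<close> is no multiple of 8 for \<open>r \<le> 3\<close> and
        \<open>a \<le> 1\<close>.\<close>
      have "f + g \<le> 1"
      proof (rule ccontr)
        assume "\<not> f + g \<le> 1"
        then have "8 * f = 3 * r + 3 + a" "r \<le> 3" "a \<le> 1" using s f g 4 by linarith+
        then show False by presburger
      qed
      then show ?thesis using s 4 by linarith
    next
      case 5
      then have "f + g < 3" using s f g by linarith
      then show ?thesis using s 5 by linarith
    qed
  qed
  then show ?thesis by (simp add: f_def g_def algebra_simps)
qed

section \<open>Chains of blocks and the flow between them\<close>

text \<open>The assumptions restrict which arcs occur; that consecutive blocks are joined is asked
  for only in \<open>chain_connected\<close>.\<close>

locale block_chain = pair_graph G for G :: "'a pair_pre_digraph" +
  fixes k :: nat and blk :: "'a \<Rightarrow> nat" and L R :: "nat \<Rightarrow> 'a"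
  assumes blk_less: "v \<in> pverts G \<Longrightarrow> blk v < k"
    and arc_between_blocks: "(u, v) \<in> parcs G \<Longrightarrow> blk u < blk v \<Longrightarrow>
      blk v = Suc (blk u) \<and> u = R (blk u) \<and> v = L (blk v)"
    and ends_nonadjacent: "(L i, R i) \<notin> parcs G"
    and ends_distinct: "L i \<noteq> R i"
    and ends_in: "i < k \<Longrightarrow> L i \<in> pverts G \<and> R i \<in> pverts G \<and> blk (L i) = i \<and> blk (R i) = i"
begin

definition block :: "nat \<Rightarrow> 'a set" where
  "block i = {v \<in> pverts G. blk v = i}"

definition exit_weight :: "nat \<Rightarrow> 'a \<Rightarrow> nat" where
  "exit_weight i v = (if v = R i then 4 else if v = L i then 1 else 2)"

text \<open>A pebble of block \<open>i\<close> contributes its exit weight in units of \<open>1/8\<close> of a pebble arriving on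
  \<open>L (Suc i)\<close>. Hence \<open>flow D i\<close> bounds the number of pebbles that can be brought from the blocks
  to the left of \<open>i\<close> into block \<open>i\<close>.\<close>

primrec flow :: "('a \<Rightarrow> nat) \<Rightarrow> nat \<Rightarrow> nat" where
  "flow D 0 = 0"
| "flow D (Suc i) = ((\<Sum>v\<in>block i. exit_weight i v * D v) + flow D i) div 8"

lemma finite_block: "finite (block i)"
  by (simp add: block_def)

lemma exit_weight_R: "exit_weight i (R i) = 4"
  by (simp add: exit_weight_def)

lemma exit_weight_L: "exit_weight i (L i) = 1"
  using ends_distinct by (simp add: exit_weight_def)

lemma arc_blocks_cases:
  assumes "(u, v) \<in> parcs G"
  obtains "blk u = blk v"
    | "blk v = Suc (blk u)" "u = R (blk u)" "v = L (blk v)"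
    | "blk u = Suc (blk v)" "v = R (blk v)" "u = L (blk u)"
  using arc_between_blocks [OF assms] arc_between_blocks [OF arcs_symmetric [OF assms]]
  by (metis linorder_neqE_nat)

text \<open>A move into block \<open>j\<close> from its left uses up one pebble of the flow, a move back restores at
  most one.\<close>

lemma flow_move:
  assumes uv: "(u, v) \<in> parcs G" and "2 \<le> D u" and D': "D' = D(u := D u - 2, v := D v + 1)"
  shows "flow D' j + of_bool (blk u < j \<and> j \<le> blk v) \<le> flow D j + of_bool (blk v < j \<and> j \<le> blk u)"
proof (induction j)
  case (Suc j)
  have [simp]: "u \<noteq> v" "v \<noteq> u" using uv no_loops' by auto
  have [simp]: "u \<in> pverts G" "v \<in> pverts G" using uv wellformed' by auto
  define W where "W D = (\<Sum>v\<in>block j. exit_weight j v * D v)" for D :: "'a \<Rightarrow> nat"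
  have W: "W D' + (if blk u = j then 2 * exit_weight j u else 0)
      = W D + (if blk v = j then exit_weight j v else 0)"
    using weighted_sum_move [OF finite_block [of j] \<open>u \<noteq> v\<close>, of D "exit_weight j"] assms
    unfolding W_def by (simp add: block_def)
  \<comment> \<open>This compares the dividends, where a crossing weighs 8; dividing by 8 turns it
    into one pebble.\<close>
  have "W D' + flow D' j + 8 * of_bool (blk u < Suc j \<and> Suc j \<le> blk v)
      \<le> W D + flow D j + 8 * of_bool (blk v < Suc j \<and> Suc j \<le> blk u)"
    using uv
  proof (cases rule: arc_blocks_cases)
    case 1
    \<comment> \<open>Only an arc from \<open>L j\<close> to \<open>R j\<close> could raise the
      weight more than twofold.\<close>
    have "exit_weight j v \<le> 2 * exit_weight j u"
      using uv ends_nonadjacent [of j] by (auto simp: exit_weight_def)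
    then show ?thesis using W Suc 1 by (auto split: if_splits)
  next
    case 2
    define i where "i = blk u"
    have blks: "blk u = i" "blk v = Suc i" "exit_weight i u = 4" "exit_weight (Suc i) v = 1"
      using 2 exit_weight_R exit_weight_L unfolding i_def by metis+
    consider "j = i" | "j = Suc i" | "j < i" | "Suc i < j" by linarith
    \<comment> \<open>For \<open>j = i\<close> the two pebbles of weight 4 pay for the crossing; for
      \<open>j = Suc i\<close> the new pebble of weight 1 replaces the one taken from
      \<open>flow D (Suc i)\<close>.\<close>
    then show ?thesis using W Suc blks by cases simp_all
  next
    case 3
    define i where "i = blk v"
    have blks: "blk v = i" "blk u = Suc i" "exit_weight i v = 4" "exit_weight (Suc i) u = 1"
      using 3 exit_weight_R exit_weight_L unfolding i_def by metis+
    consider "j = i" | "j = Suc i" | "j < i" | "Suc i < j" by linarith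
    then show ?thesis using W Suc blks by cases simp_all
  qed
  from div_le_mono [OF this, of 8] show ?case by (simp add: W_def)
qed simp

text \<open>Reflection swaps left and right, so each fact about \<open>flow\<close> yields one about
  pebbles arriving from the right.\<close>

lemma mirror_chain:
  "block_chain G k (\<lambda>v. k - 1 - blk v) (\<lambda>i. R (k - 1 - i)) (\<lambda>i. L (k - 1 - i))"
proof unfold_locales
  fix v assume "v \<in> pverts G"
  then show "k - 1 - blk v < k" using blk_less [of v] by linarith
next
  fix u v assume uv: "(u, v) \<in> parcs G" and less: "k - 1 - blk u < k - 1 - blk v"
  then have "blk v < blk u" by linarith
  with arc_between_blocks [OF arcs_symmetric [OF uv]]
  have *: "blk u = Suc (blk v)" "v = R (blk v)" "u = L (blk u)" by auto
  moreover have "blk u < k" using blk_less uv wellformed' by blast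
  ultimately have "k - 1 - (k - 1 - blk u) = blk u" "k - 1 - (k - 1 - blk v) = blk v" by simp_all
  with * less show "k - 1 - blk v = Suc (k - 1 - blk u) \<and> u = L (k - 1 - (k - 1 - blk u))
      \<and> v = R (k - 1 - (k - 1 - blk v))"
    by auto
next
  fix i show "(R (k - 1 - i), L (k - 1 - i)) \<notin> parcs G"
    using ends_nonadjacent arcs_symmetric by blast
next
  fix i show "R (k - 1 - i) \<noteq> L (k - 1 - i)" using ends_distinct by metis
next
  fix i assume "i < k"
  then show "R (k - 1 - i) \<in> pverts G \<and> L (k - 1 - i) \<in> pverts G
      \<and> k - 1 - blk (R (k - 1 - i)) = i \<and> k - 1 - blk (L (k - 1 - i)) = i"
    using ends_in [of "k - 1 - i"] by auto
qed

interpretation mirror: block_chain G k "\<lambda>v. k - 1 - blk v" "\<lambda>i. R (k - 1 - i)" "\<lambda>i. L (k - 1 - i)"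
  by (rule mirror_chain)

section \<open>Vertices that need four pebbles\<close>

definition generic :: "'a set \<Rightarrow> nat \<Rightarrow> 'a \<Rightarrow> bool" where
  "generic S i x \<longleftrightarrow> x \<in> block i \<and> x \<notin> S \<and> (\<forall>s\<in>S. (s, x) \<notin> parcs G)"

text \<open>The weights 4, 2, 1 at distance 0, 1 and at least 2 from \<open>x\<close> grow at most
  twofold along an arc. Pebbles enter the block only at its ends, which weigh 1, and the flows pay
  for them. So the potential \<open>\<Phi>\<close> never increases; it counts each initial pebble of
  the block once and is at least 4 when \<open>x\<close> is reached.\<close>

lemma generic_reachable:
  assumes x: "generic S i x" and S: "{v \<in> block i. 0 < D v} \<union> {L i, R i} \<subseteq> S"
    and reach: "pebble_reachable G D x"
  shows "4 \<le> (\<Sum>v\<in>block i. D v) + flow D i + mirror.flow D (k - 1 - i)"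
proof -
  define w where "w v = (if v = x then 4 else if (v, x) \<in> parcs G then 2 else 1 :: nat)" for v
  define W where "W D = (\<Sum>v\<in>block i. w v * D v)" for D :: "'a \<Rightarrow> nat"
  define M where "M D = mirror.flow D (k - 1 - i)" for D
  define \<Phi> where "\<Phi> D = W D + flow D i + M D" for D
  have xi: "x \<in> block i" and "i < k" using x blk_less by (auto simp: generic_def block_def)
  have wL: "w (L i) = 1" and wR: "w (R i) = 1"
    using x S by (auto simp: generic_def w_def)
  have dec: "\<Phi> D' \<le> \<Phi> D" if move: "pebbling_move G D D'" for D D'
  proof -
    from move obtain u v where uv: "(u, v) \<in> parcs G" and "2 \<le> D u"
      and D': "D' = D(u := D u - 2, v := D v + 1)"
      unfolding pebbling_move_def by blast
    note F = flow_move [OF this, of i] and M = mirror.flow_move [OF this, of "k - 1 - i"]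
    have "u \<noteq> v" using uv no_loops' by auto
    have [simp]: "u \<in> pverts G" "v \<in> pverts G" using uv wellformed' by auto
    have W: "W D' + (if blk u = i then 2 * w u else 0) = W D + (if blk v = i then w v else 0)"
      using weighted_sum_move [of "block i" u v D w] finite_block \<open>u \<noteq> v\<close> \<open>2 \<le> D u\<close> D'
      unfolding W_def by (simp add: block_def)
    have less: "blk u < k" "blk v < k" by (simp_all add: blk_less)
    have "k - 1 - a < k - 1 - b \<longleftrightarrow> b < a" "k - 1 - a \<le> k - 1 - b \<longleftrightarrow> b \<le> a"
      if "a < k" "b < k" for a b
      using that by linarith+
    then have "M D' + of_bool (i < blk u \<and> blk v \<le> i) \<le> M D + of_bool (i < blk v \<and> blk u \<le> i)"
      using M less \<open>i < k\<close> by (simp only: M_def)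
    note flows = F this
    show ?thesis
      using uv
    proof (cases rule: arc_blocks_cases)
      case 1
      have "w v \<le> 2 * w u" using uv arcs_symmetric [OF uv] no_loops' by (auto simp: w_def)
      with W flows 1 show ?thesis by (auto simp: \<Phi>_def split: if_splits)
    next
      case 2
      consider "i = blk u" | "i = blk v" | "i < blk u" | "blk v < i" using 2 by linarith
      then show ?thesis
        using W flows wL wR 2 by cases (auto simp: \<Phi>_def)
    next
      case 3
      consider "i = blk u" | "i = blk v" | "i < blk v" | "blk u < i" using 3 by linarith
      then show ?thesis
        using W flows wL wR 3 by cases (auto simp: \<Phi>_def)
    qed
  qed
  from reach obtain D' where moves: "(pebbling_move G)\<^sup>*\<^sup>* D D'" and D'x: "1 \<le> D' x"
    unfolding pebble_reachable_def by blast
  from moves have "\<Phi> D' \<le> \<Phi> D"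
    by (induction rule: rtranclp_induct) (auto intro: order_trans dec)
  moreover have "w x * D' x \<le> W D'"
    unfolding W_def using xi finite_block by (intro member_le_sum) auto
  then have "4 \<le> \<Phi> D'" using D'x by (simp add: \<Phi>_def w_def)
  moreover have "W D = (\<Sum>v\<in>block i. D v)"
    unfolding W_def
  proof (rule sum.cong)
    fix v assume "v \<in> block i"
    then show "w v * D v = D v" using x S by (cases "D v = 0") (auto simp: generic_def w_def)
  qed simp
  ultimately show ?thesis by (simp add: \<Phi>_def M_def)
qed

lemma sum_blocks: "(\<Sum>i<k. \<Sum>v\<in>block i. f v) = (\<Sum>v\<in>pverts G. f v)"
  unfolding block_def
  by (rule sum.group) (auto simp: blk_less pair_finite_verts)

text \<open>Supplies the variables of \<open>block_balance\<close>: pebbles on the left end, inside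
  and on the right end. Reflection exchanges \<open>l\<close> with \<open>r\<close>.\<close>

lemma exit_weight_sums:
  assumes "i < k"
  obtains l c r where "(\<Sum>v\<in>block i. D v) = l + c + r"
    "(\<Sum>v\<in>block i. exit_weight i v * D v) = 4 * r + 2 * c + l"
    "(\<Sum>v\<in>mirror.block (k - 1 - i). mirror.exit_weight (k - 1 - i) v * D v) = 4 * l + 2 * c + r"
proof
  define C where "C = block i - {L i, R i}"
  have B: "block i = insert (L i) (insert (R i) C)" "L i \<notin> insert (R i) C" "R i \<notin> C" "finite C"
    using ends_in [OF assms] ends_distinct finite_block by (auto simp: block_def C_def)
  have "k - 1 - (k - 1 - i) = i" using assms by simp
  then have mirror: "mirror.exit_weight (k - 1 - i) v = (if v = L i then 4 else if v = R i then 1 else 2)"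
    for v unfolding mirror.exit_weight_def by simp
  have blocks: "mirror.block (k - 1 - i) = block i"
    unfolding block_def mirror.block_def using assms blk_less by force
  have "(\<Sum>v\<in>C. exit_weight i v * D v) = 2 * (\<Sum>v\<in>C. D v)"
    unfolding sum_distrib_left by (rule sum.cong) (auto simp: C_def exit_weight_def)
  moreover have "(\<Sum>v\<in>C. mirror.exit_weight (k - 1 - i) v * D v) = 2 * (\<Sum>v\<in>C. D v)"
    unfolding sum_distrib_left mirror by (rule sum.cong) (auto simp: C_def)
  ultimately show "(\<Sum>v\<in>block i. D v) = D (L i) + (\<Sum>v\<in>C. D v) + D (R i)"
    "(\<Sum>v\<in>block i. exit_weight i v * D v) = 4 * D (R i) + 2 * (\<Sum>v\<in>C. D v) + D (L i)"
    "(\<Sum>v\<in>mirror.block (k - 1 - i). mirror.exit_weight (k - 1 - i) v * D v)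
      = 4 * D (L i) + 2 * (\<Sum>v\<in>C. D v) + D (R i)"
    unfolding blocks mirror B(1) using B(2-4) ends_distinct [of i]
    by (simp_all add: exit_weight_def)
qed

theorem optimal_pebbling_number_chain:
  assumes ex_generic: "\<And>S i. i < k \<Longrightarrow> finite S \<Longrightarrow> S \<subseteq> block i \<Longrightarrow> card S \<le> 3 * k + 2 \<Longrightarrow> \<exists>x. generic S i x"
  shows "8 * k \<le> 3 * optimal_pebbling_number G"
proof -
  obtain D where sol: "solvable G D" and size: "distribution_size G D = optimal_pebbling_number G"
    using optimal_pebbling_number_attained by blast
  define P where "P = distribution_size G D"
  define p where "p i = (\<Sum>v\<in>block i. D v)" for i
  define F where "F = flow D"
  \<comment> \<open>Block \<open>i\<close> has mirror index \<open>k - 1 - i\<close>, so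
    \<open>H i\<close> bounds the pebbles that leave it to the left, as \<open>F (Suc i)\<close>
    does to the right.\<close>
  define H where "H i = mirror.flow D (k - i)" for i
  have P: "P = (\<Sum>i<k. p i)"
    unfolding P_def p_def sum_blocks by (simp add: distribution_size_def)
  have "8 * k \<le> 3 * P"
  proof (rule ccontr)
    assume "\<not> 8 * k \<le> 3 * P"
    \<comment> \<open>A counterexample has fewer than \<open>8 * k / 3\<close> pebbles, hence at
      most \<open>3 * k\<close> pebbled vertices; the two ends of a block make it
      \<open>3 * k + 2\<close>.\<close>
    then have small: "P \<le> 3 * k" by simp
    have balance: "2 * (F (Suc i) + H i) + 8 \<le> 3 * p i + 2 * F i + 2 * H (Suc i)" if i: "i < k" for i
    proof -
      let ?T = "{v \<in> block i. 0 < D v}"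
      have "card ?T \<le> (\<Sum>v\<in>?T. D v)"
        using sum_mono [of ?T "\<lambda>_. 1" D] by simp
      also have "\<dots> \<le> P"
        unfolding P_def distribution_size_def
        by (rule sum_mono2) (auto simp: block_def pair_finite_verts)
      finally have "card ?T \<le> 3 * k" using small by simp
      moreover have "card (?T \<union> {L i, R i}) \<le> card ?T + card {L i, R i}" by (rule card_Un_le)
      moreover have "card {L i, R i} \<le> 2" by (simp add: card_insert_if)
      ultimately have "card (?T \<union> {L i, R i}) \<le> 3 * k + 2" by linarith
      moreover have "?T \<union> {L i, R i} \<subseteq> block i" using ends_in [OF i] by (auto simp: block_def)
      ultimately obtain x where x: "generic (?T \<union> {L i, R i}) i x"
        using ex_generic [OF i] finite_block by (meson finite_subset)
      have "pebble_reachable G D x"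
        using sol x by (simp add: solvable_def generic_def block_def)
      from generic_reachable [OF x order_refl this]
      have need: "4 \<le> p i + F i + H (Suc i)" by (simp add: p_def F_def H_def)
      obtain l c r where lcr: "p i = l + c + r"
        "(\<Sum>v\<in>block i. exit_weight i v * D v) = 4 * r + 2 * c + l"
        "(\<Sum>v\<in>mirror.block (k - 1 - i). mirror.exit_weight (k - 1 - i) v * D v) = 4 * l + 2 * c + r"
        using i unfolding p_def by (rule exit_weight_sums)
      have "k - i = Suc (k - 1 - i)" "k - Suc i = k - 1 - i" using i by simp_all
      then have "H i = (4 * l + 2 * c + r + H (Suc i)) div 8"
        unfolding H_def by (simp only: mirror.flow.simps lcr(3))
      moreover have "F (Suc i) = (4 * r + 2 * c + l + F i) div 8"
        using lcr(2) by (simp add: F_def)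
      ultimately show ?thesis
        using block_balance [of l c r "F i" "H (Suc i)"] need lcr(1) by simp
    qed
    have "(\<Sum>i<k. 2 * (F (Suc i) + H i) + 8) \<le> (\<Sum>i<k. 3 * p i + 2 * F i + 2 * H (Suc i))"
      using balance by (intro sum_mono) auto
    then have "2 * (\<Sum>i<k. F (Suc i)) + 2 * (\<Sum>i<k. H i) + 8 * k
      \<le> 3 * P + 2 * (\<Sum>i<k. F i) + 2 * (\<Sum>i<k. H (Suc i))"
      by (simp add: sum.distrib sum_distrib_left P algebra_simps)
    \<comment> \<open>Nothing enters the chain from outside, and what leaves it, \<open>F k\<close>
      and \<open>H 0\<close>, is nonnegative.\<close>
    moreover have "F 0 = 0" "H k = 0" by (simp_all only: F_def H_def flow.simps mirror.flow.simps diff_self_eq_0)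
    moreover have "(\<Sum>i<k. F (Suc i)) + F 0 = (\<Sum>i<k. F i) + F k"
      using sum.lessThan_Suc_shift [of F k] by simp
    moreover have "(\<Sum>i<k. H i) + H k = (\<Sum>i<k. H (Suc i)) + H 0"
      using sum.lessThan_Suc_shift [of H k] by simp
    ultimately show False using \<open>\<not> 8 * k \<le> 3 * P\<close> by simp
  qed
  then show ?thesis by (simp add: P_def size)
qed

section \<open>Diameter and connectedness of a chain\<close>

lemma awalk_crosses_blocks: "awalk u p v \<Longrightarrow> blk v \<le> blk u + length p"
proof (induction p arbitrary: u)
  case (Cons e p)
  then have e: "(u, snd e) \<in> parcs G" and "awalk (snd e) p v"
    by (auto simp: awalk_Cons_iff)
  then have "blk v \<le> blk (snd e) + length p" using Cons.IH by blast
  moreover have "blk (snd e) \<le> Suc (blk u)" using e by (rule arc_blocks_cases) auto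
  ultimately show ?case by simp
qed (simp add: awalk_Nil_iff)

lemma graph_diameter_ge:
  assumes "0 < k"
  shows "ereal (real (k - 1)) \<le> graph_diameter G"
proof -
  have L: "L 0 \<in> pverts G" "L (k - 1) \<in> pverts G" "blk (L 0) = 0" "blk (L (k - 1)) = k - 1"
    using ends_in [of 0] ends_in [of "k - 1"] assms by auto
  have cost: "awalk_cost (\<lambda>_. 1) p = real (length p)" for p
    by (induction p) simp_all
  have "ereal (real (k - 1)) \<le> graph_distance G (L 0) (L (k - 1))"
    unfolding graph_distance_def \<mu>_def
    using awalk_crosses_blocks [of "L 0" _ "L (k - 1)"] L
    by (intro INF_greatest) (auto simp: cost)
  also have "\<dots> \<le> graph_diameter G"
    unfolding graph_diameter_def using L by (intro SUP_upper2 [OF L(1)] SUP_upper)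
  finally show ?thesis .
qed

lemma chain_connected:
  assumes "0 < k" and arcs: "\<And>i. Suc i < k \<Longrightarrow> (R i, L (Suc i)) \<in> parcs G"
    and blocks: "\<And>u v. u \<in> pverts G \<Longrightarrow> v \<in> pverts G \<Longrightarrow> blk u = blk v \<Longrightarrow> u \<rightarrow>\<^sup>*\<^bsub>with_proj G\<^esub> v"
  shows "connected (with_proj G)"
proof -
  have to_0: "u \<rightarrow>\<^sup>*\<^bsub>with_proj G\<^esub> L 0" if "u \<in> pverts G" for u
    using that
  proof (induction "blk u" arbitrary: u)
    case 0
    then show ?case using blocks [of u "L 0"] ends_in [of 0] \<open>0 < k\<close> by auto
  next
    case (Suc i)
    then have i: "Suc i < k" using blk_less by metis
    have "u \<rightarrow>\<^sup>*\<^bsub>with_proj G\<^esub> L (Suc i)" using Suc blocks ends_in [OF i] by auto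
    also have "L (Suc i) \<rightarrow>\<^sup>*\<^bsub>with_proj G\<^esub> R i"
      using arcs_symmetric [OF arcs [OF i]] by auto
    also have "R i \<rightarrow>\<^sup>*\<^bsub>with_proj G\<^esub> L 0" using Suc.hyps(1) [of "R i"] ends_in [of i] i by auto
    finally show ?case .
  qed
  have "u \<rightarrow>\<^sup>*\<^bsub>with_proj G\<^esub> v" if "u \<in> pverts G" "v \<in> pverts G" for u v
    using to_0 that reachable_trans symmetric_reachable' by meson
  moreover have "pverts G \<noteq> {}" using ends_in [OF \<open>0 < k\<close>] by blast
  ultimately show ?thesis
    using reachable_mk_symmetric_eq sym_arcs by (simp add: connected_def strongly_connected_def)
qed

end

section \<open>Words that differ in all coordinates\<close>

definition words :: "nat \<Rightarrow> nat \<Rightarrow> nat list set" where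
  "words q t = {h. set h \<subseteq> {..<q} \<and> length h = t}"

lemma finite_words: "finite (words q t)"
  unfolding words_def by (rule finite_lists_length_eq) simp

lemma card_words: "card (words q t) = q ^ t"
  unfolding words_def by (simp add: card_lists_length_eq)

lemma card_words_differing:
  "h \<in> words q t \<Longrightarrow> card {h' \<in> words q t. list_all2 (\<noteq>) h h'} = (q - 1) ^ t"
proof (induction h arbitrary: t)
  case Nil
  then have "{h' \<in> words q t. list_all2 (\<noteq>) [] h'} = {[]}" "t = 0" by (auto simp: words_def)
  then show ?case by simp
next
  case (Cons a h)
  then obtain n where t: "t = Suc n" and h: "h \<in> words q n" and a: "a < q"
    by (auto simp: words_def)
  have "{h' \<in> words q t. list_all2 (\<noteq>) (a # h) h'}
      = (\<lambda>(b, h'). b # h') ` (({..<q} - {a}) \<times> {h' \<in> words q n. list_all2 (\<noteq>) h h'})"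
    by (fastforce simp: t words_def list_all2_Cons1)
  moreover have "inj_on (\<lambda>(b, h'). b # h') X" for X :: "(nat \<times> nat list) set"
    by (auto simp: inj_on_def)
  ultimately show ?case
    using a by (simp add: card_image card_cartesian_product Cons.IH [OF h] t)
qed

text \<open>With three letters each coordinate offers one that avoids both given letters. So any two
  vertices of a block have a common neighbour, which makes the block connected.\<close>

lemma words_common_differing:
  assumes "3 \<le> q" "g \<in> words q t" "h \<in> words q t"
  obtains m where "m \<in> words q t" "list_all2 (\<noteq>) g m" "list_all2 (\<noteq>) m h"
proof -
  have "\<exists>c<q. c \<noteq> a \<and> c \<noteq> b" for a b :: nat
  proof -
    have "0 < q" "1 < q" "2 < q" using assms(1) by simp_all
    then show ?thesis by (metis numeral_2_eq_2 One_nat_def n_not_Suc_n nat.distinct(1) Suc_inject)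
  qed
  then obtain c where c: "\<And>a b :: nat. c a b < q \<and> c a b \<noteq> a \<and> c a b \<noteq> b" by metis
  have "map2 c g h \<in> words q t" using assms c by (auto simp: words_def)
  moreover have "list_all2 (\<noteq>) g (map2 c g h)" "list_all2 (\<noteq>) (map2 c g h) h"
    using assms c by (auto simp: words_def list_all2_conv_all_nth) metis+
  ultimately show thesis by (rule that)
qed

text \<open>Coordinate \<open>2 * j\<close> of the new word agrees with the \<open>j\<close>-th word of \<open>S\<close>, which excludes
  adjacency; coordinate \<open>2 * j + 1\<close> does not, which excludes equality.\<close>

lemma words_undominated:
  assumes "2 \<le> q" and S: "S \<subseteq> words q t" and "2 * card S \<le> t"
  obtains x where "x \<in> words q t" "x \<notin> S" "\<And>s. s \<in> S \<Longrightarrow> \<not> list_all2 (\<noteq>) s x"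
proof -
  have "finite S" using S finite_words finite_subset by blast
  then obtain f where f: "bij_betw f {0..<card S} S" using ex_bij_betw_nat_finite by blast
  \<comment> \<open>By \<open>2 * card S \<le> t\<close> each word of \<open>S\<close> gets its two
    coordinates; at later positions the value of \<open>f\<close> is unspecified, and
    \<open>mod q\<close> still gives a letter.\<close>
  define x where "x = map (\<lambda>j. (f (j div 2) ! j + j mod 2) mod q) [0..<t]"
  have "\<not> list_all2 (\<noteq>) s x \<and> s \<noteq> x" if "s \<in> S" for s
  proof -
    have "s \<in> f ` {0..<card S}" using f \<open>s \<in> S\<close> by (simp add: bij_betw_def)
    then obtain i where i: "i < card S" "s = f i" by auto
    have t: "2 * i < t" "Suc (2 * i) < t" using i assms(3) by linarith+
    have s: "length s = t" "set s \<subseteq> {..<q}" using S \<open>s \<in> S\<close> by (auto simp: words_def)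
    then have less: "s ! j < q" if "j < t" for j
      using that nth_mem [of j s] by (simp, blast)
    have "x ! (2 * i) = s ! (2 * i)" using t less i by (simp add: x_def)
    then have "\<not> list_all2 (\<noteq>) s x" using t(1) s by (auto simp: list_all2_conv_all_nth)
    moreover have "x ! Suc (2 * i) \<noteq> s ! Suc (2 * i)"
    proof -
      have "x ! Suc (2 * i) = Suc (s ! Suc (2 * i)) mod q" using t i by (simp add: x_def)
      moreover have "Suc a mod q \<noteq> a" if "a < q" for a
        using that assms(1) by (cases "Suc a = q") auto
      ultimately show ?thesis using less t by metis
    qed
    ultimately show ?thesis by blast
  qed
  moreover have "x \<in> words q t" using assms(1) by (auto simp: x_def words_def)
  ultimately show thesis using that by blast
qed

section \<open>The chain of tensor powers\<close>

text \<open>The left end of a block is the word 00...0, the right end 01...1. They agree in the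
  first coordinate, hence are nonadjacent, and differ in the second once
  \<open>2 \<le> t\<close>.\<close>

definition tensor_adj :: "nat \<Rightarrow> nat \<times> nat list \<Rightarrow> nat \<times> nat list \<Rightarrow> bool" where
  "tensor_adj t = (\<lambda>(i, g) (j, h). i = j \<and> list_all2 (\<noteq>) g h
    \<or> j = Suc i \<and> g = 0 # replicate (t - 1) 1 \<and> h = replicate t 0
    \<or> i = Suc j \<and> g = replicate t 0 \<and> h = 0 # replicate (t - 1) 1)"

text \<open>\<open>to_nat\<close> encodes block index and word, since the final graph has vertices
  of type \<open>nat\<close>.\<close>

definition tensor_chain :: "nat \<Rightarrow> nat \<Rightarrow> nat \<Rightarrow> nat pair_pre_digraph" where
  "tensor_chain k q t = \<lparr>pverts = to_nat ` ({..<k} \<times> words q t),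
    parcs = {(to_nat u, to_nat v) | u v. u \<in> {..<k} \<times> words q t \<and> v \<in> {..<k} \<times> words q t
      \<and> tensor_adj t u v}\<rparr>"

definition tensor_blk :: "nat \<Rightarrow> nat" where
  "tensor_blk v = fst (from_nat v :: nat \<times> nat list)"

definition tensor_L :: "nat \<Rightarrow> nat \<Rightarrow> nat" where
  "tensor_L t i = to_nat (i, replicate t (0 :: nat))"

definition tensor_R :: "nat \<Rightarrow> nat \<Rightarrow> nat" where
  "tensor_R t i = to_nat (i, (0 :: nat) # replicate (t - 1) 1)"

lemma tensor_arc_iff:
  "(to_nat u, to_nat v) \<in> parcs (tensor_chain k q t)
    \<longleftrightarrow> u \<in> {..<k} \<times> words q t \<and> v \<in> {..<k} \<times> words q t \<and> tensor_adj t u v"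
  by (auto simp: tensor_chain_def)

lemma tensor_chain_finite: "finite (pverts (tensor_chain k q t))"
  by (simp add: tensor_chain_def finite_words)

lemma card_tensor_chain: "card (pverts (tensor_chain k q t)) = k * q ^ t"
  by (simp add: tensor_chain_def card_image card_cartesian_product card_words)

lemma tensor_adj_sym: "tensor_adj t u v \<Longrightarrow> tensor_adj t v u"
  by (auto simp: tensor_adj_def list_all2_conv_all_nth split: prod.splits)

lemma tensor_adj_irrefl: "0 < t \<Longrightarrow> u \<in> {..<k} \<times> words q t \<Longrightarrow> \<not> tensor_adj t u u"
  by (cases u) (auto simp: tensor_adj_def list_all2_conv_all_nth words_def)

lemma tensor_ends_words:
  assumes "2 \<le> q" "2 \<le> t"
  shows "replicate t 0 \<in> words q t" "0 # replicate (t - 1) 1 \<in> words q t"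
  using assms by (auto simp: words_def)

lemma tensor_block_chain:
  assumes "2 \<le> q" "2 \<le> t"
  shows "block_chain (tensor_chain k q t) k tensor_blk (tensor_L t) (tensor_R t)"
proof -
  let ?G = "tensor_chain k q t"
  show ?thesis
  proof unfold_locales
    show "finite (pverts ?G)" by (rule tensor_chain_finite)
    have "parcs ?G \<subseteq> pverts ?G \<times> pverts ?G" by (auto simp: tensor_chain_def)
    then show "finite (parcs ?G)" by (rule finite_subset) (simp add: tensor_chain_finite)
    fix e assume e: "e \<in> parcs ?G"
    then show "fst e \<in> pverts ?G" "snd e \<in> pverts ?G" by (auto simp: tensor_chain_def)
    show "fst e \<noteq> snd e" using e tensor_adj_irrefl [of t] assms by (auto simp: tensor_chain_def)
  next
    show "symmetric ?G"
      unfolding symmetric_def by (auto simp: sym_def tensor_chain_def dest: tensor_adj_sym)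
  next
    fix v assume "v \<in> pverts ?G"
    then show "tensor_blk v < k" by (auto simp: tensor_chain_def tensor_blk_def)
  next
    fix u v assume "(u, v) \<in> parcs ?G" "tensor_blk u < tensor_blk v"
    then show "tensor_blk v = Suc (tensor_blk u) \<and> u = tensor_R t (tensor_blk u)
        \<and> v = tensor_L t (tensor_blk v)"
      by (auto simp: tensor_chain_def tensor_blk_def tensor_R_def tensor_L_def tensor_adj_def)
  next
    fix i
    have "\<not> list_all2 (\<noteq>) (replicate t (0 :: nat)) (0 # replicate (t - 1) 1)"
      using assms by (cases t) auto
    then show "(tensor_L t i, tensor_R t i) \<notin> parcs ?G"
      unfolding tensor_L_def tensor_R_def tensor_arc_iff by (simp add: tensor_adj_def)
    obtain n where "t = Suc (Suc n)" using assms by (metis add_2_eq_Suc le_Suc_ex)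
    then show "tensor_L t i \<noteq> tensor_R t i" by (simp add: tensor_L_def tensor_R_def)
    assume "i < k"
    then show "tensor_L t i \<in> pverts ?G \<and> tensor_R t i \<in> pverts ?G
        \<and> tensor_blk (tensor_L t i) = i \<and> tensor_blk (tensor_R t i) = i"
      using tensor_ends_words [OF assms]
      by (simp add: tensor_chain_def tensor_L_def tensor_R_def tensor_blk_def)
  qed
qed

lemma tensor_chain_connected:
  assumes "0 < k" "3 \<le> q" "2 \<le> t"
  shows "connected (with_proj (tensor_chain k q t))"
proof -
  interpret block_chain "tensor_chain k q t" k tensor_blk "tensor_L t" "tensor_R t"
    using assms by (intro tensor_block_chain) auto
  show ?thesis
  proof (rule chain_connected [OF \<open>0 < k\<close>])
    fix i assume "Suc i < k"
    then show "(tensor_R t i, tensor_L t (Suc i)) \<in> parcs (tensor_chain k q t)"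
      unfolding tensor_R_def tensor_L_def tensor_arc_iff
      using tensor_ends_words [of q t] assms by (simp add: tensor_adj_def)
  next
    fix u v
    assume "u \<in> pverts (tensor_chain k q t)" "v \<in> pverts (tensor_chain k q t)"
      and "tensor_blk u = tensor_blk v"
    then obtain i g h where uv: "u = to_nat (i, g)" "v = to_nat (i, h)" "i < k"
      "g \<in> words q t" "h \<in> words q t"
      by (auto simp: tensor_chain_def tensor_blk_def)
    obtain m where m: "m \<in> words q t" "list_all2 (\<noteq>) g m" "list_all2 (\<noteq>) m h"
      using words_common_differing assms(2) uv(4,5) by blast
    have "(u, to_nat (i, m)) \<in> parcs (tensor_chain k q t)"
      "(to_nat (i, m), v) \<in> parcs (tensor_chain k q t)"
      using uv m by (simp_all add: tensor_arc_iff tensor_adj_def)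
    then show "u \<rightarrow>\<^sup>*\<^bsub>with_proj (tensor_chain k q t)\<^esub> v"
      by (meson reachable_adjI reachable_trans)
  qed
qed

lemma tensor_chain_min_degree:
  assumes "0 < k" "2 \<le> q" "2 \<le> t"
  shows "(q - 1) ^ t \<le> min_degree (tensor_chain k q t)"
proof -
  let ?G = "tensor_chain k q t"
  interpret block_chain ?G k tensor_blk "tensor_L t" "tensor_R t"
    using assms by (intro tensor_block_chain) auto
  have "(q - 1) ^ t \<le> out_degree (with_proj ?G) v" if v_in: "v \<in> pverts ?G" for v
  proof -
    obtain i h where v: "v = to_nat (i, h)" "i < k" "h \<in> words q t"
      using v_in by (auto simp: tensor_chain_def)
    let ?N = "{h' \<in> words q t. list_all2 (\<noteq>) h h'}"
    have "(q - 1) ^ t = card ((\<lambda>h'. (v, to_nat (i, h'))) ` ?N)"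
      by (subst card_image) (auto simp: inj_on_def card_words_differing v)
    also have "\<dots> \<le> out_degree (with_proj ?G) v"
      unfolding out_degree_def using v
      by (intro card_mono finite_out_arcs) (auto simp: tensor_arc_iff tensor_adj_def)
    finally show ?thesis .
  qed
  moreover have "pverts ?G \<noteq> {}" using ends_in [OF \<open>0 < k\<close>] by blast
  ultimately show ?thesis
    unfolding min_degree_def by (simp add: tensor_chain_finite)
qed

text \<open>\<open>6 * k + 4\<close> is twice \<open>3 * k + 2\<close>:
  \<open>words_undominated\<close> spends two coordinates on each excluded vertex.\<close>

lemma tensor_chain_pebbling:
  assumes "2 \<le> q" "6 * k + 4 \<le> t"
  shows "8 * k \<le> 3 * optimal_pebbling_number (tensor_chain k q t)"
proof -
  let ?G = "tensor_chain k q t"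
  interpret block_chain ?G k tensor_blk "tensor_L t" "tensor_R t"
    using assms by (intro tensor_block_chain) auto
  have block_iff: "v \<in> block i \<longleftrightarrow> i < k \<and> (\<exists>h\<in>words q t. v = to_nat (i, h))" for v i
    unfolding block_def by (auto simp: tensor_chain_def tensor_blk_def)
  show ?thesis
  proof (rule optimal_pebbling_number_chain)
    fix S i assume "i < k" "finite S" "S \<subseteq> block i" "card S \<le> 3 * k + 2"
    define T where "T = (\<lambda>v. snd (from_nat v :: nat \<times> nat list)) ` S"
    have S: "\<exists>h\<in>T. s = to_nat (i, h)" if "s \<in> S" for s
    proof -
      have "s \<in> block i" using that \<open>S \<subseteq> block i\<close> by blast
      then obtain h :: "nat list" where "s = to_nat (i, h)" by (auto simp: block_iff)
      with that show ?thesis by (force simp: T_def)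
    qed
    have "T \<subseteq> words q t"
      using \<open>S \<subseteq> block i\<close> by (fastforce simp: T_def block_iff)
    moreover have "card T \<le> card S" unfolding T_def using \<open>finite S\<close> by (rule card_image_le)
    then have "2 * card T \<le> t" using \<open>card S \<le> 3 * k + 2\<close> assms(2) by linarith
    ultimately obtain x where x: "x \<in> words q t" "x \<notin> T" "\<And>h. h \<in> T \<Longrightarrow> \<not> list_all2 (\<noteq>) h x"
      using words_undominated assms(1) by blast
    have "generic S i (to_nat (i, x))"
      unfolding generic_def
    proof (intro conjI ballI)
      show "to_nat (i, x) \<in> block i"
        using x \<open>i < k\<close> by (simp add: block_iff)
      show "to_nat (i, x) \<notin> S" using S x(2) by fastforce
      show "(s, to_nat (i, x)) \<notin> parcs ?G" if "s \<in> S" for s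
        using S [OF that] x(3) by (auto simp: tensor_arc_iff tensor_adj_def)
    qed
    then show "\<exists>x. generic S i x" by blast
  qed
qed

section \<open>Choice of the parameters\<close>

theorem theorem3:
  fixes \<epsilon> :: real and d :: int
  assumes "\<epsilon> > 0"
  shows "\<exists>G :: nat pair_pre_digraph.
    pair_graph G \<and> Digraph_Component.connected (with_proj G) \<and>
    graph_diameter G > ereal (real_of_int d) \<and>
    real (optimal_pebbling_number G)
      \<ge> (8 / 3 - \<epsilon>) * (real (card (pverts G)) / (real (min_degree G) + 1))"
proof -
  define k where "k = nat \<bar>d\<bar> + 2"
  define t where "t = 6 * k + 4"
  \<comment> \<open>By Bernoulli's inequality \<open>((q - 1) / q) ^ t\<close> is at least
    \<open>1 - t / q\<close>, and this \<open>q\<close> makes that at least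
    \<open>1 - 3 * \<epsilon> / 8\<close>; the minimum 3 serves connectedness.\<close>
  define q where "q = max 3 (nat \<lceil>8 * real t / (3 * \<epsilon>)\<rceil>)"
  define G where "G = tensor_chain k q t"
  have q: "3 \<le> q" "8 * real t / (3 * \<epsilon>) \<le> real q" and t: "2 \<le> t" and k: "0 < k"
    by (auto simp: q_def t_def k_def intro: order_trans [OF real_nat_ceiling_ge] max.cobounded2)
  interpret block_chain G k tensor_blk "tensor_L t" "tensor_R t"
    unfolding G_def using q(1) t by (intro tensor_block_chain) auto
  have "ereal (real_of_int d) < ereal (real (k - 1))" by (simp add: k_def)
  also have "\<dots> \<le> graph_diameter G" using k by (rule graph_diameter_ge)
  finally have diam: "graph_diameter G > ereal (real_of_int d)" .
  have "(8 / 3 - \<epsilon>) * real (q ^ t) \<le> 8 / 3 * real ((q - 1) ^ t)"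
  proof -
    have "8 * real t \<le> 3 * \<epsilon> * real q"
      using q(2) assms by (simp add: field_simps)
    then have "8 / 3 - \<epsilon> \<le> 8 / 3 * (1 + real t * (- 1 / real q))"
      using q(1) by (simp add: field_simps)
    also have "\<dots> \<le> 8 / 3 * (1 + (- 1 / real q)) ^ t"
      using q(1) by (intro mult_left_mono Bernoulli_inequality) (auto simp: field_simps)
    finally have "(8 / 3 - \<epsilon>) * real q ^ t \<le> 8 / 3 * (1 + (- 1 / real q)) ^ t * real q ^ t"
      by (intro mult_right_mono) auto
    also have "\<dots> = 8 / 3 * ((1 + (- 1 / real q)) * real q) ^ t"
      by (simp add: power_mult_distrib)
    also have "(1 + (- 1 / real q)) * real q = real (q - 1)"
      using q(1) by (simp add: field_simps of_nat_diff)
    finally show ?thesis by simp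
  qed
  also have "\<dots> \<le> 8 / 3 * (real (min_degree G) + 1)"
    using tensor_chain_min_degree [of k q t] k q(1) t by (simp add: G_def flip: of_nat_power)
  finally have "(8 / 3 - \<epsilon>) * real (q ^ t) * real k \<le> 8 / 3 * (real (min_degree G) + 1) * real k"
    by (rule mult_right_mono) simp
  then have "(8 / 3 - \<epsilon>) * (real (card (pverts G)) / (real (min_degree G) + 1)) \<le> 8 / 3 * real k"
    by (simp add: G_def card_tensor_chain divide_simps algebra_simps)
  also have "\<dots> \<le> real (optimal_pebbling_number G)"
    using tensor_chain_pebbling [of q k t] q(1) by (simp add: G_def t_def)
  finally have "(8 / 3 - \<epsilon>) * (real (card (pverts G)) / (real (min_degree G) + 1))
    \<le> real (optimal_pebbling_number G)" .
  moreover have "Digraph_Component.connected (with_proj G)"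
    unfolding G_def using k q(1) t by (rule tensor_chain_connected)
  ultimately show ?thesis using pair_graph diam by blast
qed

end
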